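(* Let $n\ge 1$, let $t\in\mathbb{R}$ with $1\le t\le\sqrt n$, and let $\mathbf v\in\mathbb{R}^n$. Let $\mathbf x$ be the optimal solution of the problem of minimizing $\tfrac12\|\mathbf x-\mathbf v\|_2^2$ over all $\mathbf x\in\mathbb{R}^n_+$ with $\|\mathbf x\|_1\le t$ and $\|\mathbf x\|_2\le 1$. Then one of the following statements must be true: (i) $\|\mathbf v^+\|_2\le 1$ and $\|\mathbf v^+\|_1\le t$. In this case $\mathbf x=\mathbf v^+$. (ii) $\|\mathbf v^+\|_2>1$ and $\|\mathbf v^+\|_1\le t\|\mathbf v^+\|_2$. In this case $\mathbf x=\mathbf v^+/\|\mathbf v^+\|_2$. (iii) $\|\mathbf v^+\|_1>t$ and $\|\mathbf v^+\|_1>t\|\mathbf v^+\|_2$. In this case $\psi(\lambda)=0$ has a unique root $\hat\lambda$ in $(0,v_{\max})$. Furthermore, if $\|(\mathbf v-\hat\lambda\mathbf 1)^+\|_2\le 1$, then $\mathbf x=(\mathbf v-\hat\lambda\mathbf 1)^+$; otherwise $\phi(\lambda)=0$ has a unique root $\lambda^*$ in $(0,\hat\lambda)$, and $$\mathbf x=\frac{(\mathbf v-\lambda^*\mathbf 1)^+}{\|(\mathbf v-\lambda^*\mathbf 1)^+\|_2}.$$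
   Context: $\mathbb{R}^n_+$ is the nonnegative orthant; $\mathbf 1\in\mathbb{R}^n$ is the all-ones vector; $\mathbf v^+=\max(\mathbf v,0)$ componentwise; $v_{\max}=\max_i v_i$. For $\lambda\in\mathbb{R}$ define $$\psi(\lambda)=\|(\mathbf v-\lambda\mathbf 1)^+\|_1-t,\qquad \phi(\lambda)=\|(\mathbf v-\lambda\mathbf 1)^+\|_1^2-t^2\|(\mathbf v-\lambda\mathbf 1)^+\|_2^2 .$$ *)

theory Defs
  imports "HOL-Analysis.Analysis"
begin

definition l1norm :: "real ^ 'n \<Rightarrow> real" where
  "l1norm x = (\<Sum>i\<in>UNIV. \<bar>x $ i\<bar>)"

definition pos_part :: "real ^ 'n \<Rightarrow> real ^ 'n" where
  "pos_part v = (\<chi> i. max (v $ i) 0)"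

definition vmax :: "real ^ 'n \<Rightarrow> real" where
  "vmax v = Max (range (\<lambda>i. v $ i))"

text \<open>The shifted positive part; the literal \<open>1\<close> of type \<open>real ^ 'n\<close> is the all-ones vector.\<close>

definition shift_pos :: "real ^ 'n \<Rightarrow> real \<Rightarrow> real ^ 'n" where
  "shift_pos v l = pos_part (v - l *\<^sub>R 1)"

definition psi :: "real \<Rightarrow> real ^ 'n \<Rightarrow> real \<Rightarrow> real" where
  "psi t v l = l1norm (shift_pos v l) - t"

definition phi :: "real \<Rightarrow> real ^ 'n \<Rightarrow> real \<Rightarrow> real" where
  "phi t v l = (l1norm (shift_pos v l))\<^sup>2 - t\<^sup>2 * (norm (shift_pos v l))\<^sup>2"

definition feasible :: "real \<Rightarrow> real ^ 'n \<Rightarrow> bool" where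
  "feasible t x \<longleftrightarrow> (\<forall>i. 0 \<le> x $ i) \<and> l1norm x \<le> t \<and> norm x \<le> 1"

definition optimal :: "real \<Rightarrow> real ^ 'n \<Rightarrow> real ^ 'n \<Rightarrow> bool" where
  "optimal t v x \<longleftrightarrow> is_arg_min (\<lambda>y. 1/2 * (norm (y - v))\<^sup>2) (feasible t) x"

text \<open>The optimal solution exists and is unique, so a hypothesis \<open>optimal t v x\<close> pins down \<open>x\<close>
  and is never vacuous for \<open>t \<ge> 0\<close>.\<close>

lemma ex1_optimal:
  fixes v :: "real ^ 'n"
  assumes "0 \<le> t"
  shows "\<exists>!x. optimal t v x"
proof -
  let ?S = "{x :: real ^ 'n. feasible t x}"
  have eq: "?S = (\<Inter>i. {x. 0 \<le> x $ i}) \<inter> {x. l1norm x \<le> t} \<inter> {x. norm x \<le> 1}"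
    by (auto simp: feasible_def)
  have cl: "closed ?S"
    unfolding eq l1norm_def
    by (intro closed_Int closed_INT ballI closed_Collect_le continuous_intros)
  have c1: "convex {x :: real ^ 'n. 0 \<le> x $ i}" for i
    by (rule convexI) auto
  have c2: "convex {x :: real ^ 'n. l1norm x \<le> t}"
  proof (rule convexI, clarsimp)
    fix x y :: "real ^ 'n" and a b :: real
    assume h: "l1norm x \<le> t" "l1norm y \<le> t" "0 \<le> a" "0 \<le> b" "a + b = 1"
    have "l1norm (a *\<^sub>R x + b *\<^sub>R y) \<le> a * l1norm x + b * l1norm y"
      unfolding l1norm_def sum_distrib_left sum.distrib[symmetric]
    proof (rule sum_mono)
      fix i
      have "\<bar>a * x $ i + b * y $ i\<bar> \<le> \<bar>a * x $ i\<bar> + \<bar>b * y $ i\<bar>"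
        by (rule abs_triangle_ineq)
      then show "\<bar>(a *\<^sub>R x + b *\<^sub>R y) $ i\<bar> \<le> a * \<bar>x $ i\<bar> + b * \<bar>y $ i\<bar>"
        using h by (simp add: abs_mult)
    qed
    also have "\<dots> \<le> a * t + b * t"
      using h by (intro add_mono mult_left_mono) auto
    also have "\<dots> = t" using h by (metis distrib_right mult_1)
    finally show "l1norm (a *\<^sub>R x + b *\<^sub>R y) \<le> t" .
  qed
  have c3: "convex {x :: real ^ 'n. norm x \<le> 1}"
    using convex_cball[of "0 :: real ^ 'n" 1] by (simp add: cball_def)
  have cv: "convex ?S"
    unfolding eq by (intro convex_Int convex_INT c1 c2 c3)
  have "0 \<in> ?S" using assms by (simp add: feasible_def l1norm_def)
  then have ne: "?S \<noteq> {}" by blast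
  have opt: "optimal t v x \<longleftrightarrow> x \<in> ?S \<and> (\<forall>y\<in>?S. dist v x \<le> dist v y)" for x
  proof -
    have "1/2 * (norm (x - v))\<^sup>2 \<le> 1/2 * (norm (y - v))\<^sup>2 \<longleftrightarrow> dist v x \<le> dist v y" for y
      by (simp add: dist_norm norm_minus_commute[of v] power2_le_iff_abs_le)
    then show ?thesis
      unfolding optimal_def is_arg_min_linorder by blast
  qed
  obtain x where x: "x \<in> ?S" and xm: "\<And>y. y \<in> ?S \<Longrightarrow> dist v x \<le> dist v y"
    by (rule distance_attains_inf[OF cl ne, of v]) blast
  have xb: "\<forall>y\<in>?S. dist v x \<le> dist v y" by (intro ballI xm)
  show ?thesis
  proof (rule ex1I)
    show "optimal t v x" unfolding opt by (intro conjI x xb)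
  next
    fix y assume "optimal t v y"
    then have y: "y \<in> ?S" "\<forall>z\<in>?S. dist v y \<le> dist v z" unfolding opt by blast+
    show "y = x" by (rule any_closest_point_unique[OF cv cl y(1) x y(2) xb])
  qed
qed

end

theory Submission
  imports Defs
begin

text \<open>
  A feasible point whose residual \<open>v - x\<close> makes no acute angle with any feasible direction is
  optimal, and the optimal solution is unique because the feasible set is convex. The Lagrange
  conditions supply such points: if \<open>l \<ge> 0\<close> is a multiplier for the 1-norm constraint and
  \<open>c - 1 \<ge> 0\<close> one for the 2-norm constraint, stationarity together with complementarity for
  \<open>x \<ge> 0\<close> reads \<open>(v - l 1)\<^sup>+ = c x\<close>. Lemma \<open>optimal_of_multipliers\<close> states that for a
  feasible \<open>x\<close> this and complementary slackness suffice.

  All cases of the theorem are instances. Cases (i) and (ii) take \<open>l = 0\<close>, with \<open>c = 1\<close> or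
  \<open>c\<close> the norm of the positive part of \<open>v\<close>. In case (iii) the 1-norm constraint is active. Its
  multiplier is the root of \<open>psi\<close> if the 2-norm of the shifted positive part there is at most 1,
  and a root of \<open>phi\<close> otherwise, for when the shifted positive part is nonzero, \<open>phi = 0\<close> says
  exactly that its normalization has 1-norm \<open>t\<close>.

  Roots exist by the intermediate value theorem, and \<open>psi\<close> is strictly decreasing below \<open>vmax v\<close>.
  For \<open>phi\<close> uniqueness is less direct: two roots yield the same optimal point, so the positive
  parts at the two shifts are proportional. This forces the entries of \<open>v\<close> on their support to be
  equal (\<open>shift_pos_proportional_propagates\<close>), so the positive part at every later shift is
  proportional to them as well, and \<open>phi\<close>, being homogeneous in the shifted vector, vanishes there
  too. Yet \<open>phi < 0\<close> at the root of \<open>psi\<close> if the 2-norm there exceeds 1.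
\<close>

section \<open>The shifted positive part\<close>

lemma shift_pos_nth [simp]: "shift_pos v l $ i = max (v $ i - l) 0"
  by (simp add: shift_pos_def pos_part_def)

lemma shift_pos_0: "shift_pos v 0 = pos_part v"
  by (simp add: shift_pos_def)

lemma l1norm_shift_pos: "l1norm (shift_pos v l) = (\<Sum>i\<in>UNIV. max (v $ i - l) 0)"
  by (simp add: l1norm_def)

lemma l1norm_scaleR: "l1norm (k *\<^sub>R x) = \<bar>k\<bar> * l1norm x"
  by (simp add: l1norm_def abs_mult sum_distrib_left)

lemma l1norm_nonneg: "0 \<le> l1norm x"
  by (simp add: l1norm_def sum_nonneg)

lemma norm_shift_pos_antimono:
  assumes "l \<le> m"
  shows "norm (shift_pos v m) \<le> norm (shift_pos v l)"
  by (rule norm_le_componentwise_cart) (use assms in auto)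

lemma l1norm_shift_pos_strict:
  fixes v :: "real ^ 'n"
  assumes "l < m" and "l < vmax v"
  shows "l1norm (shift_pos v m) < l1norm (shift_pos v l)"
  unfolding l1norm_shift_pos
proof (rule sum_strict_mono_ex1)
  have "vmax v \<in> range (\<lambda>i. v $ i)"
    unfolding vmax_def by (rule Max_in) auto
  then obtain i where "vmax v = v $ i" by blast
  with assms show "\<exists>i\<in>UNIV. max (v $ i - m) 0 < max (v $ i - l) 0"
    by (intro bexI[of _ i]) auto
qed (use assms in auto)

lemma shift_pos_vmax: "shift_pos v (vmax v) = 0"
proof -
  have "v $ i \<le> vmax v" for i
    unfolding vmax_def by (rule Max_ge) auto
  then show ?thesis by (simp add: vec_eq_iff max_def antisym)
qed

lemma continuous_on_shift_pos: "continuous_on S (\<lambda>l. shift_pos v l)"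
  unfolding shift_pos_def pos_part_def by (intro continuous_intros)

lemma continuous_on_psi: "continuous_on S (psi t v)"
  unfolding psi_def[abs_def] l1norm_def
  by (intro continuous_intros continuous_on_component continuous_on_shift_pos)

lemma continuous_on_phi: "continuous_on S (phi t v)"
  unfolding phi_def[abs_def] l1norm_def
  by (intro continuous_intros continuous_on_component continuous_on_shift_pos)

section \<open>Sufficiency of the multiplier conditions\<close>

lemma optimal_of_obtuse_residual:
  fixes v x :: "real ^ 'n"
  assumes "feasible t x" and "\<And>y. feasible t y \<Longrightarrow> (v - x) \<bullet> (y - x) \<le> 0"
  shows "optimal t v x"
  unfolding optimal_def is_arg_min_linorder
proof (intro conjI allI impI assms(1))
  fix y :: "real ^ 'n" assume "feasible t y"
  then have "(v - x) \<bullet> (y - x) \<le> 0" by (rule assms(2))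
  moreover have "(norm (y - v))\<^sup>2 = (norm (y - x))\<^sup>2 + (norm (x - v))\<^sup>2 - 2 * ((v - x) \<bullet> (y - x))"
    unfolding power2_norm_eq_inner by (simp add: inner_diff inner_commute algebra_simps)
  ultimately show "1/2 * (norm (x - v))\<^sup>2 \<le> 1/2 * (norm (y - v))\<^sup>2"
    using zero_le_power2[of "norm (y - x)"] by linarith
qed

text \<open>
  The residual splits as \<open>v - x = l 1 + (c - 1) x - w\<close>, where \<open>w \<ge> 0\<close> is supported off the
  support of \<open>x\<close>. Against \<open>y - x\<close> the first two terms contribute at most 0 by complementary
  slackness and Cauchy-Schwarz, and the third contributes \<open>- w \<bullet> y \<le> 0\<close>.
\<close>

lemma optimal_of_multipliers:
  fixes v x :: "real ^ 'n"
  assumes "0 \<le> l" and "1 \<le> c" and sc: "shift_pos v l = c *\<^sub>R x" and x: "feasible t x"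
    and l1: "l = 0 \<or> l1norm x = t" and l2: "c = 1 \<or> norm x = 1"
  shows "optimal t v x"
proof (rule optimal_of_obtuse_residual[OF x])
  fix y :: "real ^ 'n" assume y: "feasible t y"
  have comp: "(v $ i - x $ i) * (y $ i - x $ i)
      \<le> l * (y $ i - x $ i) + (c - 1) * (x $ i * y $ i - x $ i * x $ i)" for i
  proof -
    have s: "max (v $ i - l) 0 = c * x $ i"
      using arg_cong[OF sc, of "\<lambda>z. z $ i"] by simp
    show ?thesis
    proof (cases "l \<le> v $ i")
      case True
      then have "v $ i = l + c * x $ i" using s by simp
      then show ?thesis by (simp add: algebra_simps)
    next
      case False
      then have "x $ i = 0" using s \<open>1 \<le> c\<close> by simp
      moreover have "v $ i * y $ i \<le> l * y $ i"
        using False y by (intro mult_right_mono) (auto simp: feasible_def)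
      ultimately show ?thesis by simp
    qed
  qed
  have sums: "l1norm z = (\<Sum>i\<in>UNIV. z $ i)" if "feasible t z" for z :: "real ^ 'n"
    using that by (simp add: feasible_def l1norm_def)
  have "(v - x) \<bullet> (y - x) = (\<Sum>i\<in>UNIV. (v $ i - x $ i) * (y $ i - x $ i))"
    by (simp add: inner_vec_def)
  also have "\<dots> \<le> (\<Sum>i\<in>UNIV. l * (y $ i - x $ i) + (c - 1) * (x $ i * y $ i - x $ i * x $ i))"
    by (intro sum_mono comp)
  also have "\<dots> = l * (l1norm y - l1norm x) + (c - 1) * (x \<bullet> y - x \<bullet> x)"
    by (simp add: sum.distrib sum_distrib_left sum_subtractf sums[OF x] sums[OF y]
        inner_vec_def flip: sum_distrib_left)
  also have "\<dots> \<le> 0"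
  proof -
    have "l * (l1norm y - l1norm x) \<le> 0"
      using l1
    proof
      assume "l1norm x = t"
      then show ?thesis
        using y \<open>0 \<le> l\<close> by (intro mult_nonneg_nonpos) (auto simp: feasible_def)
    qed simp
    moreover have "(c - 1) * (x \<bullet> y - x \<bullet> x) \<le> 0"
      using l2
    proof
      assume "norm x = 1"
      then have "x \<bullet> y \<le> 1" and "x \<bullet> x = 1"
        using norm_cauchy_schwarz[of x y] y
        by (simp_all add: feasible_def dot_square_norm)
      then show ?thesis using \<open>1 \<le> c\<close> by (intro mult_nonneg_nonpos) auto
    qed simp
    ultimately show ?thesis by linarith
  qed
  finally show "(v - x) \<bullet> (y - x) \<le> 0" .
qed

lemma optimal_shift_pos:
  assumes "0 \<le> l" and "l1norm (shift_pos v l) \<le> t" and "norm (shift_pos v l) \<le> 1"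
    and "l = 0 \<or> l1norm (shift_pos v l) = t"
  shows "optimal t v (shift_pos v l)"
  using assms by (intro optimal_of_multipliers[of l 1]) (auto simp: feasible_def)

lemma optimal_normalized_shift_pos:
  fixes v :: "real ^ 'n"
  assumes "0 \<le> l" and n: "norm (shift_pos v l) > 1"
    and le: "l1norm (shift_pos v l) \<le> t * norm (shift_pos v l)"
    and eq: "l = 0 \<or> l1norm (shift_pos v l) = t * norm (shift_pos v l)"
  shows "optimal t v (shift_pos v l /\<^sub>R norm (shift_pos v l))"
proof (rule optimal_of_multipliers)
  let ?s = "shift_pos v l" and ?x = "shift_pos v l /\<^sub>R norm (shift_pos v l)"
  have l1: "l1norm ?x = l1norm ?s / norm ?s"
    by (simp add: l1norm_scaleR divide_inverse mult.commute)
  have pos: "norm ?s > 0" using n by linarith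
  have nz: "?s \<noteq> 0" using pos by force
  then have n1: "norm ?x = 1" by simp
  show "feasible t ?x"
    unfolding feasible_def using l1 n1 pos le by (auto simp: divide_le_eq)
  show "l = 0 \<or> l1norm ?x = t" using eq pos l1 by (auto simp: field_simps)
  show "norm ?s = 1 \<or> norm ?x = 1" using n1 by blast
  show "1 \<le> norm ?s" using n by simp
  show "shift_pos v l = norm ?s *\<^sub>R ?x" using nz by simp
qed (fact assms)

section \<open>The roots of \<open>psi\<close> and \<open>phi\<close>\<close>

lemma psi_unique_root:
  fixes v :: "real ^ 'n"
  assumes "0 < t" and gt: "l1norm (pos_part v) > t"
  shows "\<exists>!l. l \<in> {0<..<vmax v} \<and> psi t v l = 0"
proof -
  have p0: "psi t v 0 > 0" using gt by (simp add: psi_def shift_pos_0)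
  have pm: "psi t v (vmax v) < 0" using \<open>0 < t\<close> by (simp add: psi_def shift_pos_vmax l1norm_def)
  have "0 < vmax v"
  proof (rule ccontr)
    assume "\<not> 0 < vmax v"
    moreover have "v $ i \<le> vmax v" for i
      unfolding vmax_def by (rule Max_ge) auto
    ultimately have "v $ i \<le> 0" for i by (meson not_less order_trans)
    then have "pos_part v = 0" by (simp add: pos_part_def vec_eq_iff max_def antisym)
    then show False using assms by (simp add: l1norm_def)
  qed
  then obtain l where "0 \<le> l" "l \<le> vmax v" "psi t v l = 0"
    using IVT2'[of "psi t v" "vmax v" 0 0] p0 pm continuous_on_psi by force
  moreover from this have "l \<noteq> 0" "l \<noteq> vmax v" using p0 pm by auto
  ultimately have l: "l \<in> {0<..<vmax v} \<and> psi t v l = 0" by auto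
  have "\<not> a < b" if "a \<in> {0<..<vmax v}" "psi t v a = 0" "psi t v b = 0" for a b
    using l1norm_shift_pos_strict[of a b v] that by (auto simp: psi_def)
  with l show ?thesis by (metis linorder_neqE)
qed

lemma phi_eq_0_iff:
  assumes "0 \<le> t"
  shows "phi t v l = 0 \<longleftrightarrow> l1norm (shift_pos v l) = t * norm (shift_pos v l)"
proof -
  have "phi t v l = 0 \<longleftrightarrow> (l1norm (shift_pos v l))\<^sup>2 = (t * norm (shift_pos v l))\<^sup>2"
    by (simp add: phi_def power_mult_distrib)
  also have "\<dots> \<longleftrightarrow> l1norm (shift_pos v l) = t * norm (shift_pos v l)"
    by (rule power2_eq_iff_nonneg) (use assms l1norm_nonneg in auto)
  finally show ?thesis .
qed

lemma phi_of_scaled: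
  assumes "shift_pos v m = k *\<^sub>R shift_pos v l"
  shows "phi t v m = k\<^sup>2 * phi t v l"
  unfolding phi_def assms by (simp add: l1norm_scaleR power_mult_distrib algebra_simps)

text \<open>
  Both vectors are supported where \<open>v\<close> exceeds \<open>b\<close>, and solving
  \<open>v $ i - a = k (v $ i - b)\<close> there gives the same value \<open>v $ i\<close> for every such \<open>i\<close>: the
  equation is affine and \<open>k = 1\<close> is impossible as \<open>a \<noteq> b\<close>.
\<close>

lemma shift_pos_proportional_propagates:
  fixes v :: "real ^ 'n"
  assumes "a < b" and "b \<le> m" and scaled: "shift_pos v a = k *\<^sub>R shift_pos v b"
  obtains r where "shift_pos v m = r *\<^sub>R shift_pos v b"
proof -
  have eq: "max (v $ i - a) 0 = k * max (v $ i - b) 0" for i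
    using arg_cong[OF scaled, of "\<lambda>z. z $ i"] by simp
  define V where "V = (k * b - a) / (k - 1)"
  have V: "v $ i = V" if "b < v $ i" for i
  proof -
    have e: "v $ i - a = k * (v $ i - b)" using eq[of i] that \<open>a < b\<close> by simp
    then have "k \<noteq> 1" using \<open>a < b\<close> by auto
    then show ?thesis using e by (simp add: V_def field_simps)
  qed
  have "shift_pos v m = (max (V - m) 0 / (V - b)) *\<^sub>R shift_pos v b"
  proof (simp only: vec_eq_iff, intro allI)
    fix i
    show "shift_pos v m $ i = ((max (V - m) 0 / (V - b)) *\<^sub>R shift_pos v b) $ i"
      using V[of i] \<open>b \<le> m\<close> by (cases "b < v $ i") auto
  qed
  then show ?thesis by (rule that)
qed

lemma phi_unique_root:
  fixes v :: "real ^ 'n"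
  assumes "0 < t" and gt: "l1norm (pos_part v) > t * norm (pos_part v)"
    and "0 < m" and psi0: "psi t v m = 0" and n: "norm (shift_pos v m) > 1"
  shows "\<exists>!l. l \<in> {0<..<m} \<and> phi t v l = 0"
proof -
  have p0: "phi t v 0 > 0"
  proof -
    have "(t * norm (pos_part v))\<^sup>2 < (l1norm (pos_part v))\<^sup>2"
      using gt \<open>0 < t\<close> by (intro power_strict_mono) auto
    then show ?thesis by (simp add: phi_def shift_pos_0 power_mult_distrib)
  qed
  have pm: "phi t v m < 0"
  proof -
    have "1 < (norm (shift_pos v m))\<^sup>2" using n by (simp add: one_less_power)
    then show ?thesis using psi0 \<open>0 < t\<close> by (simp add: phi_def psi_def)
  qed
  obtain l where "0 \<le> l" "l \<le> m" "phi t v l = 0"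
    using IVT2'[of "phi t v" m 0 0] p0 pm \<open>0 < m\<close> continuous_on_phi by force
  moreover from this have "l \<noteq> 0" "l \<noteq> m" using p0 pm by auto
  ultimately have l: "l \<in> {0<..<m} \<and> phi t v l = 0" by auto
  have opt: "norm (shift_pos v a) > 1"
      "optimal t v (shift_pos v a /\<^sub>R norm (shift_pos v a))"
    if "a \<in> {0<..<m}" "phi t v a = 0" for a
  proof -
    show "norm (shift_pos v a) > 1"
      using norm_shift_pos_antimono[of a m v] that n by auto
    then show "optimal t v (shift_pos v a /\<^sub>R norm (shift_pos v a))"
      using that \<open>0 < t\<close> by (intro optimal_normalized_shift_pos) (auto simp: phi_eq_0_iff)
  qed
  have "\<not> a < b" if a: "a \<in> {0<..<m}" "phi t v a = 0" and b: "b \<in> {0<..<m}" "phi t v b = 0"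
    for a b
  proof
    assume "a < b"
    have "shift_pos v a /\<^sub>R norm (shift_pos v a) = shift_pos v b /\<^sub>R norm (shift_pos v b)"
      using ex1_optimal[of t v] \<open>0 < t\<close> opt(2)[OF a] opt(2)[OF b] by auto
    then have "norm (shift_pos v a) *\<^sub>R (shift_pos v a /\<^sub>R norm (shift_pos v a))
        = norm (shift_pos v a) *\<^sub>R (shift_pos v b /\<^sub>R norm (shift_pos v b))"
      by (rule arg_cong)
    moreover have "norm (shift_pos v a) \<noteq> 0" using opt(1)[OF a] by linarith
    ultimately have "shift_pos v a
        = (norm (shift_pos v a) / norm (shift_pos v b)) *\<^sub>R shift_pos v b"
      by (simp add: divide_inverse)
    then obtain r where "shift_pos v m = r *\<^sub>R shift_pos v b"
      by (rule shift_pos_proportional_propagates[of a b m, OF \<open>a < b\<close>, rotated]) (use b in auto)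
    then have "phi t v m = 0" using phi_of_scaled b by fastforce
    then show False using pm by simp
  qed
  with l show ?thesis by (metis linorder_neqE)
qed

section \<open>The optimal solution\<close>

theorem theorem4p2:
  fixes v x :: "real ^ 'n" and t :: real
  assumes "1 \<le> t" and "t \<le> sqrt (real CARD('n))"
    and "optimal t v x"
  shows
    "(norm (pos_part v) \<le> 1 \<and> l1norm (pos_part v) \<le> t
        \<and> x = pos_part v)
     \<or> (norm (pos_part v) > 1 \<and> l1norm (pos_part v) \<le> t * norm (pos_part v)
        \<and> x = pos_part v /\<^sub>R norm (pos_part v))
     \<or> (l1norm (pos_part v) > t \<and> l1norm (pos_part v) > t * norm (pos_part v)
        \<and> (\<exists>!lh. lh \<in> {0<..<vmax v} \<and> psi t v lh = 0)
        \<and> (\<forall>lh. lh \<in> {0<..<vmax v} \<and> psi t v lh = 0 \<longrightarrow>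
             (if norm (shift_pos v lh) \<le> 1
              then x = shift_pos v lh
              else (\<exists>!ls. ls \<in> {0<..<lh} \<and> phi t v ls = 0)
                 \<and> (\<forall>ls. ls \<in> {0<..<lh} \<and> phi t v ls = 0 \<longrightarrow>
                      x = shift_pos v ls /\<^sub>R norm (shift_pos v ls)))))"
proof -
  have t0: "0 < t" using assms(1) by simp
  have x_eq: "x = z" if "optimal t v z" for z
    using ex1_optimal[of t v] t0 assms(3) that by auto
  consider (inside) "norm (pos_part v) \<le> 1" "l1norm (pos_part v) \<le> t"
    | (ball) "norm (pos_part v) > 1" "l1norm (pos_part v) \<le> t * norm (pos_part v)"
    | (shifted) "l1norm (pos_part v) > t" "l1norm (pos_part v) > t * norm (pos_part v)"
  proof -
    have "t < t * norm (pos_part v)" if "1 < norm (pos_part v)" using that t0 by simp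
    moreover have "t * norm (pos_part v) \<le> t" if "norm (pos_part v) \<le> 1"
      using that t0 by simp
    ultimately show ?thesis using that by force
  qed
  then show ?thesis
  proof cases
    case inside
    then have "x = pos_part v"
      using optimal_shift_pos[of 0 v t] by (intro x_eq) (simp add: shift_pos_0)
    with inside show ?thesis by blast
  next
    case ball
    then have "x = pos_part v /\<^sub>R norm (pos_part v)"
      using optimal_normalized_shift_pos[of 0 v t] by (intro x_eq) (simp add: shift_pos_0)
    with ball show ?thesis by blast
  next
    case shifted
    have "if norm (shift_pos v lh) \<le> 1
          then x = shift_pos v lh
          else (\<exists>!ls. ls \<in> {0<..<lh} \<and> phi t v ls = 0)
             \<and> (\<forall>ls. ls \<in> {0<..<lh} \<and> phi t v ls = 0 \<longrightarrow>
                  x = shift_pos v ls /\<^sub>R norm (shift_pos v ls))"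
      if lh: "lh \<in> {0<..<vmax v} \<and> psi t v lh = 0" for lh
    proof (cases "norm (shift_pos v lh) \<le> 1")
      case True
      then have "x = shift_pos v lh"
        using lh by (intro x_eq optimal_shift_pos) (auto simp: psi_def)
      with True show ?thesis by simp
    next
      case False
      then have "\<exists>!ls. ls \<in> {0<..<lh} \<and> phi t v ls = 0"
        using lh shifted t0 by (intro phi_unique_root) auto
      moreover have "x = shift_pos v ls /\<^sub>R norm (shift_pos v ls)"
        if ls: "ls \<in> {0<..<lh} \<and> phi t v ls = 0" for ls
      proof -
        have "norm (shift_pos v ls) > 1"
          using norm_shift_pos_antimono[of ls lh v] ls False by auto
        then show ?thesis
          using ls t0 by (intro x_eq optimal_normalized_shift_pos) (auto simp: phi_eq_0_iff)
      qed
      ultimately show ?thesis using False by simp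
    qed
    with shifted psi_unique_root[OF t0 shifted(1)] show ?thesis by blast
  qed
qed

end
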